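(* Let $\Delta\subset\mathbb{R}^n$ be an $n$-simplex with pieces $\Delta_1,\dots,\Delta_N$, contractive similarities $L_i:\Delta\to\Delta_i$, scaling vector $\alpha=(\alpha_1,\dots,\alpha_N)$, fixed $k\in\mathbb{N}$, and functions $g,b$, all as described in the context (including the join-up condition). For $f\in\mathcal{C}_0(\Delta)$ define $\mathcal{T}(f)$ on $\Delta=\bigcup_{\mathbf{i}\in\{1,\dots,N\}^k}\Delta_{\mathbf{i}}$ by $$\mathcal{T}(f)(x)=g(x)+\alpha_{\mathbf{i}}\,(f-b)\big(L_{\mathbf{i}}^{-1}(x)\big)\qquad\text{for }x\in\Delta_{\mathbf{i}},\ \mathbf{i}\in\{1,\dots,N\}^k.$$ Then $\mathcal{T}$ is a well-defined operator $\mathcal{C}_0(\Delta)\to\mathcal{C}_0(\Delta)$, and it is contractive on $\mathcal{C}_0(\Delta)$ with respect to the metric induced by the sup norm $\|\cdot\|_{\infty,\Delta}$, i.e. there is a constant $c\in[0,1)$ such that $\|\mathcal{T}(f_1)-\mathcal{T}(f_2)\|_{\infty,\Delta}\le c\,\|f_1-f_2\|_{\infty,\Delta}$ for all $f_1,f_2\in\mathcal{C}_0(\Delta)$.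
   Context: An $n$-simplex $\Delta$ in $\mathbb{R}^n$ is the convex hull of $n+1$ affinely independent points of $\mathbb{R}^n$ (its vertices); $V_0$ denotes its vertex set. $\Delta_1,\dots,\Delta_N$ are non-empty compact subsets of $\Delta$ such that: (A1) $\Delta=\bigcup_{i=1}^N\Delta_i$; (A2) each $\Delta_i$ is similar to $\Delta$; (A3) the $\Delta_i$ are mutually congruent and $(\Delta_i)^\circ\cap(\Delta_j)^\circ=\emptyset$ for $i\ne j$, where $A^\circ$ is the interior of $A$. For each $i$, $L_i:\Delta\to\Delta_i$ is a bijective contractive similarity $L_i=c_iO_i+t_i$ with $0<c_i<1$, $O_i$ an orthogonal transformation of $\mathbb{R}^n$ and $t_i\in\mathbb{R}^n$ a translation. The scaling vector is $\alpha=(\alpha_1,\dots,\alpha_N)\in\mathbb{R}^N$ with $|\alpha_i|<1$ for all $i$. Fix $k\in\mathbb{N}$, $k\ge1$. For $\mathbf{i}=(i_1,\dots,i_k)\in\{1,\dots,N\}^k$ put $L_{\mathbf{i}}=L_{i_1}\circ\cdots\circ L_{i_k}$, $\Delta_{\mathbf{i}}=L_{\mathbf{i}}(\Delta)$, $V_{\mathbf{i}}$ = the vertex set of $\Delta_{\mathbf{i}}$, $\alpha_{\mathbf{i}}=\alpha_{i_1}\cdots\alpha_{i_k}$, and $Z_k=\bigcup_{\mathbf{i}\in\{1,\dots,N\}^k}V_{\mathbf{i}}$. $\mathcal{C}(\Delta)$ is the space of continuous functions $\Delta\to\mathbb{R}$ with norm $\|f\|_{\infty,\Delta}=\sup_{x\in\Delta}|f(x)|$.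 Fix $g\in\mathcal{C}(\Delta)$ and set $\mathcal{C}_0(\Delta)=\{f\in\mathcal{C}(\Delta): f(v)=g(v)\text{ for all }v\in Z_k\}$. The base function $b:\Delta\to\mathbb{R}$ is continuous, satisfies $b(v)=g(v)$ for all $v\in Z_k$ (so $b\in\mathcal{C}_0(\Delta)$), and $b\neq g$. Join-up condition (standing assumption): for all $\mathbf{i},\mathbf{j}\in\{1,\dots,N\}^k$, all $x\in\Delta_{\mathbf{i}}\cap\Delta_{\mathbf{j}}$ and all $f\in\mathcal{C}_0(\Delta)$, $\alpha_{\mathbf{i}}(f-b)(L_{\mathbf{i}}^{-1}(x))=\alpha_{\mathbf{j}}(f-b)(L_{\mathbf{j}}^{-1}(x))$. *)

theory Defs
  imports "HOL-Analysis.Analysis"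
begin

section \<open>Simplices, similarity and congruence\<close>

definition simplex_vertices :: "'a::euclidean_space set \<Rightarrow> 'a set" where
  "simplex_vertices S = (THE C. \<not> affine_dependent C \<and> S = convex hull C)"

lemma simplex_vertices_convex_hull:
  assumes "\<not> affine_dependent C"
  shows "simplex_vertices (convex hull C) = C"
  unfolding simplex_vertices_def
proof (rule the_equality)
  fix D assume D: "\<not> affine_dependent D \<and> convex hull C = convex hull D"
  have "x \<in> D \<longleftrightarrow> x \<in> C" for x
    using assms D extreme_point_of_convex_hull_affine_independent by metis
  then show "D = C" by blast
qed (use assms in simp)

definition similar_sets :: "'a::euclidean_space set \<Rightarrow> 'a set \<Rightarrow> bool" where
  "similar_sets A B \<longleftrightarrow>
     (\<exists>r Q t. 0 < r \<and> orthogonal_transformation Q \<and> B = (\<lambda>x. r *\<^sub>R Q x + t) ` A)"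

definition congruent_sets :: "'a::euclidean_space set \<Rightarrow> 'a set \<Rightarrow> bool" where
  "congruent_sets A B \<longleftrightarrow>
     (\<exists>Q t. orthogonal_transformation Q \<and> B = (\<lambda>x. Q x + t) ` A)"

text \<open>The values of \<open>h\<close> outside \<open>A\<close> are left unconstrained.\<close>

definition contractive_similarity_on ::
    "'a::euclidean_space set \<Rightarrow> ('a \<Rightarrow> 'a) \<Rightarrow> bool" where
  "contractive_similarity_on A h \<longleftrightarrow>
     (\<exists>c Q t. 0 < c \<and> c < 1 \<and> orthogonal_transformation Q \<and> (\<forall>x\<in>A. h x = c *\<^sub>R Q x + t))"


section \<open>Multi-indices\<close>

text \<open>The multi-index \<open>(i\<^sub>1, \<dots>, i\<^sub>k)\<close> is the list \<open>[i\<^sub>1, \<dots>, i\<^sub>k]\<close>.\<close>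

definition multi_indices :: "nat \<Rightarrow> nat \<Rightarrow> nat list set" where
  "multi_indices N k = {w. length w = k \<and> set w \<subseteq> {1..N}}"

text \<open>\<open>L\<^sub>w = L i\<^sub>1 \<circ> \<dots> \<circ> L i\<^sub>k\<close>, so the last index of the list is applied first.\<close>

definition comp_map :: "(nat \<Rightarrow> 'a \<Rightarrow> 'a) \<Rightarrow> nat list \<Rightarrow> 'a \<Rightarrow> 'a" where
  "comp_map L w = foldr (\<lambda>i h. L i \<circ> h) w id"

definition piece :: "'a set \<Rightarrow> (nat \<Rightarrow> 'a \<Rightarrow> 'a) \<Rightarrow> nat list \<Rightarrow> 'a set" where
  "piece \<Delta> L w = comp_map L w ` \<Delta>"

definition comp_map_inv :: "'a set \<Rightarrow> (nat \<Rightarrow> 'a \<Rightarrow> 'a) \<Rightarrow> nat list \<Rightarrow> 'a \<Rightarrow> 'a" where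
  "comp_map_inv \<Delta> L w = inv_into \<Delta> (comp_map L w)"

definition scaling :: "(nat \<Rightarrow> real) \<Rightarrow> nat list \<Rightarrow> real" where
  "scaling \<alpha> w = prod_list (map \<alpha> w)"

definition level_vertices ::
    "'a::euclidean_space set \<Rightarrow> (nat \<Rightarrow> 'a \<Rightarrow> 'a) \<Rightarrow> nat \<Rightarrow> nat \<Rightarrow> 'a set" where
  "level_vertices \<Delta> L N k = (\<Union>w\<in>multi_indices N k. simplex_vertices (piece \<Delta> L w))"


section \<open>Function spaces and the operator\<close>

text \<open>Functions on \<open>A\<close> are represented by total functions that are \<open>undefined\<close> off \<open>A\<close>,
  so that equality of representatives is equality of functions on \<open>A\<close>.\<close>

definition cont_fun :: "'a::topological_space set \<Rightarrow> ('a \<Rightarrow> real) set" where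
  "cont_fun A = {f \<in> extensional A. continuous_on A f}"

definition cont_fun_interp ::
    "'a::topological_space set \<Rightarrow> 'a set \<Rightarrow> ('a \<Rightarrow> real) \<Rightarrow> ('a \<Rightarrow> real) set" where
  "cont_fun_interp A Z g = {f \<in> cont_fun A. \<forall>v\<in>Z. f v = g v}"

definition sup_norm :: "'a set \<Rightarrow> ('a \<Rightarrow> real) \<Rightarrow> real" where
  "sup_norm A f = (SUP x\<in>A. \<bar>f x\<bar>)"

text \<open>The value at \<open>x\<close> is the common value prescribed by all pieces containing \<open>x\<close>.
  The description operator carries no information unless such a value exists and is unique,
  so well-definedness is the statement that the defining equation holds on every piece.\<close>

definition rb_operator ::
    "'a set \<Rightarrow> (nat \<Rightarrow> 'a \<Rightarrow> 'a) \<Rightarrow> nat \<Rightarrow> nat \<Rightarrow> (nat \<Rightarrow> real) \<Rightarrow>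
     ('a \<Rightarrow> real) \<Rightarrow> ('a \<Rightarrow> real) \<Rightarrow> ('a \<Rightarrow> real) \<Rightarrow> 'a \<Rightarrow> real" where
  "rb_operator \<Delta> L N k \<alpha> g b f = (\<lambda>x\<in>\<Delta>. THE y. \<forall>w\<in>multi_indices N k. x \<in> piece \<Delta> L w \<longrightarrow>
     y = g x + scaling \<alpha> w * (f (comp_map_inv \<Delta> L w x) - b (comp_map_inv \<Delta> L w x)))"

end

theory Submission
  imports Defs
begin

text \<open>
  Subtracting the defining equations gives \<open>T f\<^sub>1 - T f\<^sub>2 = \<alpha>\<^sub>w (f\<^sub>1 - f\<^sub>2) \<circ> L\<^sub>w\<^sup>-\<^sup>1\<close> on the
  piece \<open>\<Delta>\<^sub>w\<close>, so \<open>T\<close> contracts by the largest \<open>\<bar>\<alpha>\<^sub>w\<bar>\<close>. Continuity is obtained by pasting over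
  the finitely many compact pieces. For the interpolation condition, \<open>L\<^sub>w\<^sup>-\<^sup>1\<close> takes a vertex of
  \<open>\<Delta>\<^sub>w\<close> to a vertex \<open>p\<close> of \<open>\<Delta>\<close>, and \<open>f - b\<close> vanishes there because \<open>p\<close> is itself in \<open>Z\<^sub>k\<close>:
  it lies in some piece, and an extreme point of \<open>\<Delta>\<close> is an extreme point of any convex subset
  containing it.
\<close>

section \<open>Affine images of simplices and their vertices\<close>

lemma affine_dependent_linear_image_inj:
  fixes A :: "'a::euclidean_space \<Rightarrow> 'b::real_normed_vector"
  assumes "linear A" "inj A" "affine_dependent (A ` C)"
  shows "affine_dependent C"
proof -
  obtain x where x: "x \<in> C" "A x \<in> affine hull (A ` C - {A x})"
    using assms(3) unfolding affine_dependent_def by blast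
  have "A ` C - {A x} = A ` (C - {x})"
    using assms(2) by (auto simp: inj_def)
  then have "A x \<in> A ` (affine hull (C - {x}))"
    using x(2) assms(1) by (simp add: linear_conv_bounded_linear affine_hull_linear_image)
  then have "x \<in> affine hull (C - {x})"
    using assms(2) by (auto simp: inj_def)
  then show ?thesis
    using x(1) unfolding affine_dependent_def by blast
qed

text \<open>Since \<open>simplex_vertices\<close> is a definite description, it is evaluated by
  exhibiting an affinely independent set with the right convex hull. The image of \<open>C\<close>
  is one: injective linear maps and translations preserve affine independence, and both commute with
  convex hulls.\<close>

lemma simplex_vertices_affine_image:
  fixes A :: "'a::euclidean_space \<Rightarrow> 'a"
  assumes "linear A" "inj A" "\<not> affine_dependent C"
  shows "(\<lambda>x. A x + t) ` (convex hull C) = convex hull ((\<lambda>x. A x + t) ` C)"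
    and "simplex_vertices ((\<lambda>x. A x + t) ` (convex hull C)) = (\<lambda>x. A x + t) ` C"
proof -
  have split: "(\<lambda>x. A x + t) ` S = (\<lambda>x. t + x) ` A ` S" for S
    by (auto simp: image_image add.commute)
  show hull: "(\<lambda>x. A x + t) ` (convex hull C) = convex hull ((\<lambda>x. A x + t) ` C)"
    using assms(1) by (simp add: split convex_hull_translation convex_hull_linear_image)
  have "\<not> affine_dependent ((\<lambda>x. A x + t) ` C)"
    using affine_dependent_linear_image_inj[OF assms(1,2)] assms(3)
    by (metis split affine_dependent_translation_eq)
  then show "simplex_vertices ((\<lambda>x. A x + t) ` (convex hull C)) = (\<lambda>x. A x + t) ` C"
    by (simp add: hull simplex_vertices_convex_hull)
qed

lemma contractive_similarity_on_affine:
  assumes "contractive_similarity_on S h"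
  obtains A t where "linear A" "inj A" "\<And>x. x \<in> S \<Longrightarrow> h x = A x + t"
proof -
  obtain c Q t where c: "0 < c" and Q: "orthogonal_transformation Q"
    and h: "\<forall>x\<in>S. h x = c *\<^sub>R Q x + t"
    using assms unfolding contractive_similarity_on_def by blast
  have "linear (\<lambda>x. c *\<^sub>R Q x)"
    using orthogonal_transformation_linear[OF Q] by (rule linear_compose_scale_right)
  moreover have "inj (\<lambda>x. c *\<^sub>R Q x)"
    using orthogonal_transformation_inj[OF Q] c by (auto simp: inj_def)
  ultimately show thesis
    using h that by blast
qed

section \<open>Composed maps along a multi-index\<close>

lemma comp_map_simps [simp]:
  "comp_map L [] = id" "comp_map L (i # w) = L i \<circ> comp_map L w"
  by (simp_all add: comp_map_def)

lemma comp_map_maps_to: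
  assumes "\<And>i. i \<in> set w \<Longrightarrow> L i ` S \<subseteq> S"
  shows "comp_map L w ` S \<subseteq> S"
  using assms
proof (induction w)
  case (Cons i w)
  then have "comp_map L w ` S \<subseteq> S" "L i ` S \<subseteq> S" by auto
  then show ?case by (auto simp: image_subset_iff)
qed simp

text \<open>Injective affine maps are closed under composition. This single form later yields the
  injectivity and continuity of \<open>comp_map L w\<close> on \<Delta> as well as the vertices of
  its image.\<close>

lemma comp_map_affine:
  assumes "\<And>i. i \<in> set w \<Longrightarrow> contractive_similarity_on S (L i)"
    and "\<And>i. i \<in> set w \<Longrightarrow> L i ` S \<subseteq> S"
  shows "\<exists>A t. linear A \<and> inj A \<and> (\<forall>x\<in>S. comp_map L w x = A x + t)"
  using assms
proof (induction w)
  case Nil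
  show ?case
    by (rule exI[of _ id], rule exI[of _ 0]) (simp add: linear_id[unfolded id_def] id_def)
next
  case (Cons i w)
  obtain A t where A: "linear A" "inj A" and At: "\<forall>x\<in>S. comp_map L w x = A x + t"
    using Cons by auto
  obtain B u where B: "linear B" "inj B" and Bu: "\<And>x. x \<in> S \<Longrightarrow> L i x = B x + u"
    using contractive_similarity_on_affine Cons.prems(1) by (metis list.set_intros(1))
  \<comment> \<open>The affine formula for \<open>L i\<close> is known only on \<open>S\<close>, so
    it may be applied to the inner composition only after checking that the latter stays in
    \<open>S\<close>.\<close>
  have "comp_map L w ` S \<subseteq> S"
    by (rule comp_map_maps_to) (use Cons.prems(2) in auto)
  then have "\<forall>x\<in>S. comp_map L (i # w) x = (B \<circ> A) x + (B t + u)"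
    using At Bu by (auto simp: image_subset_iff linear_add[OF B(1)] add.assoc)
  moreover have "linear (B \<circ> A)" "inj (B \<circ> A)"
    using A B by (auto intro: linear_compose inj_compose)
  ultimately show ?case by blast
qed

section \<open>Multi-indices and the covering by pieces\<close>

lemma finite_multi_indices: "finite (multi_indices N k)"
proof -
  have "multi_indices N k = {w. set w \<subseteq> {1..N} \<and> length w = k}"
    by (auto simp: multi_indices_def)
  then show ?thesis by (simp add: finite_lists_length_eq)
qed

lemma multi_indices_Suc:
  "multi_indices N (Suc k) = (\<Union>i\<in>{1..N}. (#) i ` multi_indices N k)"
  by (auto simp: multi_indices_def length_Suc_conv image_iff)

text \<open>Induction on the level: the head of the list is the outermost map, so the pieces of
  level \<open>Suc k\<close> are the images under the \<open>L i\<close> of those of level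
  \<open>k\<close>, whose union is already \<open>S\<close>.\<close>

lemma Union_pieces:
  assumes "S = (\<Union>i\<in>{1..N}. L i ` S)"
  shows "S = (\<Union>w\<in>multi_indices N k. piece S L w)"
proof (induction k)
  case 0
  have "multi_indices N 0 = {[]}" by (auto simp: multi_indices_def)
  then show ?case by (simp add: piece_def)
next
  case (Suc k)
  have "(\<Union>w\<in>multi_indices N (Suc k). piece S L w)
      = (\<Union>i\<in>{1..N}. L i ` (\<Union>w\<in>multi_indices N k. piece S L w))"
    by (auto simp: multi_indices_Suc piece_def image_comp image_UN)
  also have "\<dots> = S" using Suc assms by simp
  finally show ?case by simp
qed

section \<open>Bounds for scaling factors and for the sup norm\<close>

lemma abs_scaling_le_1:
  assumes "\<And>i. i \<in> set w \<Longrightarrow> \<bar>\<alpha> i\<bar> \<le> 1"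
  shows "\<bar>scaling \<alpha> w\<bar> \<le> 1"
  using assms by (induction w) (auto simp: scaling_def abs_mult intro!: mult_le_one)

text \<open>One factor strictly below 1 suffices once the product of the others is at most 1. The
  list must be nonempty because the empty product is 1.\<close>

lemma abs_scaling_less_1:
  assumes "w \<noteq> []" and "\<And>i. i \<in> set w \<Longrightarrow> \<bar>\<alpha> i\<bar> < 1"
  shows "\<bar>scaling \<alpha> w\<bar> < 1"
proof -
  obtain i v where w: "w = i # v" using assms(1) by (cases w) auto
  have "\<bar>scaling \<alpha> v\<bar> \<le> 1"
    by (rule abs_scaling_le_1) (use assms(2) w in \<open>auto intro: less_imp_le\<close>)
  then have "\<bar>\<alpha> i\<bar> * \<bar>scaling \<alpha> v\<bar> \<le> \<bar>\<alpha> i\<bar> * 1"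
    by (intro mult_left_mono) auto
  also have "\<dots> < 1" using assms(2) w by simp
  finally show ?thesis by (simp add: w scaling_def abs_mult)
qed

text \<open>A real supremum dominates the values only if they are bounded above; compactness
  supplies the bound.\<close>

lemma abs_le_sup_norm:
  assumes "compact S" "continuous_on S f" "x \<in> S"
  shows "\<bar>f x\<bar> \<le> sup_norm S f"
proof -
  have "compact ((\<lambda>x. \<bar>f x\<bar>) ` S)"
    using assms(1,2) by (intro compact_continuous_image continuous_intros)
  then have "bdd_above ((\<lambda>x. \<bar>f x\<bar>) ` S)"
    by (intro bounded_imp_bdd_above compact_imp_bounded)
  then show ?thesis
    unfolding sup_norm_def by (rule cSUP_upper[OF assms(3)])
qed

text \<open>Extremality passes from \<open>S\<close> to a piece through \<open>p\<close>, because
  segments in the piece are segments between points of \<open>S\<close>. The piece is the convex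
  hull of the image of \<open>C\<close>, and every extreme point of a convex hull belongs to the
  generating set.\<close>

lemma simplex_vertices_subset_level_vertices:
  assumes C: "\<not> affine_dependent C" and S: "S = convex hull C"
    and cover: "S = (\<Union>w\<in>multi_indices N k. piece S L w)"
    and aff: "\<And>w. w \<in> multi_indices N k \<Longrightarrow>
      \<exists>A t. linear A \<and> inj A \<and> (\<forall>x\<in>S. comp_map L w x = A x + t)"
  shows "C \<subseteq> level_vertices S L N k"
proof
  fix p assume "p \<in> C"
  then have p: "p extreme_point_of S"
    using C S extreme_point_of_convex_hull_affine_independent by blast
  then obtain w where w: "w \<in> multi_indices N k" "p \<in> piece S L w"
    using cover unfolding extreme_point_of_def by blast
  obtain A t where A: "linear A" "inj A" and At: "\<forall>x\<in>S. comp_map L w x = A x + t"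
    using aff[OF w(1)] by blast
  have piece: "piece S L w = (\<lambda>x. A x + t) ` (convex hull C)"
    using At unfolding piece_def S by (auto simp: image_iff)
  have "p extreme_point_of (piece S L w)"
    using p w cover unfolding extreme_point_of_def by blast
  then have "p \<in> simplex_vertices (piece S L w)"
    unfolding piece simplex_vertices_affine_image(2)[OF A C]
    unfolding simplex_vertices_affine_image(1)[OF A C]
    by (rule extreme_point_of_convex_hull)
  then show "p \<in> level_vertices S L N k"
    using w(1) unfolding level_vertices_def by blast
qed

theorem theorem3p1:
  fixes \<Delta> :: "(real ^ 'n) set"
    and D :: "nat \<Rightarrow> (real ^ 'n) set"
    and L :: "nat \<Rightarrow> real ^ 'n \<Rightarrow> real ^ 'n"
    and N k :: nat
    and \<alpha> :: "nat \<Rightarrow> real"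
    and g b :: "real ^ 'n \<Rightarrow> real"
  defines "Z \<equiv> level_vertices \<Delta> L N k"
  defines "C0 \<equiv> cont_fun_interp \<Delta> Z g"
  defines "T \<equiv> rb_operator \<Delta> L N k \<alpha> g b"
  assumes simplex: "int CARD('n) simplex \<Delta>"
    and pieces: "\<And>i. i \<in> {1..N} \<Longrightarrow> D i \<noteq> {} \<and> compact (D i) \<and> D i \<subseteq> \<Delta>"
    and A1: "\<Delta> = (\<Union>i\<in>{1..N}. D i)"
    and A2: "\<And>i. i \<in> {1..N} \<Longrightarrow> similar_sets \<Delta> (D i)"
    and A3_congruent: "\<And>i j. i \<in> {1..N} \<Longrightarrow> j \<in> {1..N} \<Longrightarrow> congruent_sets (D i) (D j)"
    and A3_interior: "\<And>i j. i \<in> {1..N} \<Longrightarrow> j \<in> {1..N} \<Longrightarrow> i \<noteq> j \<Longrightarrow>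
                        interior (D i) \<inter> interior (D j) = {}"
    and L_bij: "\<And>i. i \<in> {1..N} \<Longrightarrow> bij_betw (L i) \<Delta> (D i)"
    and L_sim: "\<And>i. i \<in> {1..N} \<Longrightarrow> contractive_similarity_on \<Delta> (L i)"
    and scaling_lt_1: "\<And>i. i \<in> {1..N} \<Longrightarrow> \<bar>\<alpha> i\<bar> < 1"
    and k: "k \<ge> 1"
    and g: "g \<in> cont_fun \<Delta>"
    and b: "b \<in> C0" "b \<noteq> g"
    and join_up: "\<And>w u x f. w \<in> multi_indices N k \<Longrightarrow> u \<in> multi_indices N k \<Longrightarrow>
          x \<in> piece \<Delta> L w \<inter> piece \<Delta> L u \<Longrightarrow> f \<in> C0 \<Longrightarrow>
          scaling \<alpha> w * (f (comp_map_inv \<Delta> L w x) - b (comp_map_inv \<Delta> L w x)) =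
          scaling \<alpha> u * (f (comp_map_inv \<Delta> L u x) - b (comp_map_inv \<Delta> L u x))"
  shows "\<Delta> = (\<Union>w\<in>multi_indices N k. piece \<Delta> L w) \<and>
    (\<forall>f\<in>C0. \<forall>w\<in>multi_indices N k. \<forall>x\<in>piece \<Delta> L w.
       T f x = g x + scaling \<alpha> w * (f (comp_map_inv \<Delta> L w x) - b (comp_map_inv \<Delta> L w x))) \<and>
    T \<in> C0 \<rightarrow> C0 \<and>
    (\<exists>c. 0 \<le> c \<and> c < 1 \<and>
       (\<forall>f1\<in>C0. \<forall>f2\<in>C0.
          sup_norm \<Delta> (\<lambda>x. T f1 x - T f2 x) \<le> c * sup_norm \<Delta> (\<lambda>x. f1 x - f2 x)))"
proof -
  define I where "I = multi_indices N k"
  obtain C where C: "\<not> affine_dependent C" and card: "int (card C) = int CARD('n) + 1"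
    and hull: "\<Delta> = convex hull C"
    using simplex unfolding simplex_def by blast
  have "C \<noteq> {}" using card by auto
  then have nonempty: "\<Delta> \<noteq> {}" by (simp add: hull)
  have compact: "compact \<Delta>"
    by (simp add: hull finite_imp_compact_convex_hull aff_independent_finite[OF C])

  have image_L: "L i ` \<Delta> = D i" if "i \<in> {1..N}" for i
    using L_bij[OF that] by (simp add: bij_betw_def)
  have cover: "\<Delta> = (\<Union>w\<in>I. piece \<Delta> L w)"
    unfolding I_def by (rule Union_pieces) (use A1 image_L in simp)
  have aff: "\<exists>A t. linear A \<and> inj A \<and> (\<forall>x\<in>\<Delta>. comp_map L w x = A x + t)" if "w \<in> I" for w
  proof (rule comp_map_affine)
    fix i assume "i \<in> set w"
    then have "i \<in> {1..N}" using that by (auto simp: I_def multi_indices_def)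
    then show "contractive_similarity_on \<Delta> (L i)" "L i ` \<Delta> \<subseteq> \<Delta>"
      using L_sim image_L pieces by auto
  qed
  have C_Z: "C \<subseteq> Z"
    unfolding Z_def
    using simplex_vertices_subset_level_vertices[OF C hull] cover aff by (simp add: I_def)

  have inj: "inj_on (comp_map L w) \<Delta>" if "w \<in> I" for w
    using aff[OF that] by (auto simp: inj_on_def inj_def)
  have cont: "continuous_on \<Delta> (comp_map L w)" if w: "w \<in> I" for w
  proof -
    obtain A t where A: "linear A" and At: "\<forall>x\<in>\<Delta>. comp_map L w x = A x + t"
      using aff[OF w] by blast
    have "continuous_on \<Delta> (\<lambda>x. A x + t)"
      by (intro continuous_intros linear_continuous_on linear_linear[THEN iffD2] A)
    then show ?thesis using At by (simp cong: continuous_on_cong)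
  qed
  have inv_in: "comp_map_inv \<Delta> L w x \<in> \<Delta>" if "x \<in> piece \<Delta> L w" for w x
    using that unfolding comp_map_inv_def piece_def by (rule inv_into_into)
  have inv_eq: "comp_map_inv \<Delta> L w (comp_map L w p) = p" if "w \<in> I" "p \<in> \<Delta>" for w p
    unfolding comp_map_inv_def using inj[OF that(1)] that(2) by (rule inv_into_f_f)
  \<comment> \<open>A continuous injection on a compact set has a continuous inverse on its
    image.\<close>
  have inv_cont: "continuous_on (piece \<Delta> L w) (comp_map_inv \<Delta> L w)" if "w \<in> I" for w
    unfolding piece_def
    by (rule continuous_on_inv[OF cont[OF that] compact]) (use inv_eq that in simp)
  have closed_piece: "closed (piece \<Delta> L w)" if "w \<in> I" for w
    unfolding piece_def
    by (intro compact_imp_closed compact_continuous_image cont[OF that] compact)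

  have T_eq: "T f x = g x + scaling \<alpha> w * (f (comp_map_inv \<Delta> L w x) - b (comp_map_inv \<Delta> L w x))"
    if "f \<in> C0" "w \<in> I" "x \<in> piece \<Delta> L w" for f w x
  proof -
    have "x \<in> \<Delta>" using that cover by blast
    moreover have "(THE y. \<forall>u\<in>I. x \<in> piece \<Delta> L u \<longrightarrow>
        y = g x + scaling \<alpha> u * (f (comp_map_inv \<Delta> L u x) - b (comp_map_inv \<Delta> L u x)))
      = g x + scaling \<alpha> w * (f (comp_map_inv \<Delta> L w x) - b (comp_map_inv \<Delta> L w x))"
    \<comment> \<open>Existence of the described value is the join-up condition, comparing
      \<open>w\<close> with any other piece through \<open>x\<close>. Uniqueness follows by
      instantiating the quantifier at \<open>w\<close> itself.\<close>
    proof (rule the_equality)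
      show "\<forall>u\<in>I. x \<in> piece \<Delta> L u \<longrightarrow>
          g x + scaling \<alpha> w * (f (comp_map_inv \<Delta> L w x) - b (comp_map_inv \<Delta> L w x)) =
          g x + scaling \<alpha> u * (f (comp_map_inv \<Delta> L u x) - b (comp_map_inv \<Delta> L u x))"
        using join_up[of w _ x f] that by (auto simp: I_def)
    qed (use that in blast)
    ultimately show ?thesis
      by (simp add: T_def rb_operator_def I_def)
  qed

  have C0_iff: "f \<in> C0 \<longleftrightarrow> f \<in> extensional \<Delta> \<and> continuous_on \<Delta> f \<and> (\<forall>v\<in>Z. f v = g v)" for f
    by (auto simp: C0_def cont_fun_interp_def cont_fun_def)
  have cont_g: "continuous_on \<Delta> g" using g by (simp add: cont_fun_def)
  have T_C0: "T f \<in> C0" if f: "f \<in> C0" for f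
    unfolding C0_iff
  proof (intro conjI ballI)
    show "T f \<in> extensional \<Delta>" by (simp add: T_def rb_operator_def)
    have "continuous_on (piece \<Delta> L w) (T f)" if w: "w \<in> I" for w
    proof -
      have pull: "continuous_on (piece \<Delta> L w) (\<lambda>x. h (comp_map_inv \<Delta> L w x))"
        if "continuous_on \<Delta> h" for h :: "real ^ 'n \<Rightarrow> real"
        using that inv_cont[OF w] by (rule continuous_on_compose2) (use inv_in in auto)
      have "continuous_on (piece \<Delta> L w) g"
        using cont_g by (rule continuous_on_subset) (use cover w in blast)
      then have "continuous_on (piece \<Delta> L w)
          (\<lambda>x. g x + scaling \<alpha> w * (f (comp_map_inv \<Delta> L w x) - b (comp_map_inv \<Delta> L w x)))"
        using f b(1) by (intro continuous_intros pull) (auto simp: C0_iff)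
      then show ?thesis
        using T_eq[OF f w] by (simp cong: continuous_on_cong)
    qed
    then have "continuous_on (\<Union>w\<in>I. piece \<Delta> L w) (T f)"
      using finite_multi_indices closed_piece
      by (intro continuous_on_closed_Union) (auto simp: I_def)
    then show "continuous_on \<Delta> (T f)" using cover by simp
    fix v assume "v \<in> Z"
    then obtain w where w: "w \<in> I" and v: "v \<in> simplex_vertices (piece \<Delta> L w)"
      by (auto simp: Z_def level_vertices_def I_def)
    obtain A t where A: "linear A" "inj A" and At: "\<forall>x\<in>\<Delta>. comp_map L w x = A x + t"
      using aff[OF w] by blast
    have "piece \<Delta> L w = (\<lambda>x. A x + t) ` (convex hull C)"
      using At unfolding piece_def hull by (auto simp: image_iff)
    then obtain p where p: "p \<in> C" and vp: "v = A p + t"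
      using v simplex_vertices_affine_image(2)[OF A C] by auto
    have p\<Delta>: "p \<in> \<Delta>" using p hull by (simp add: hull_inc)
    then have v_eq: "v = comp_map L w p" using vp At by simp
    then have "v \<in> piece \<Delta> L w" using p\<Delta> by (simp add: piece_def)
    \<comment> \<open>Both functions equal \<open>g\<close> on \<open>Z\<close>, which contains
      \<open>p\<close> by \<open>C_Z\<close>.\<close>
    moreover have "f p = b p" using f b(1) p C_Z by (auto simp: C0_iff)
    ultimately show "T f v = g v"
      using T_eq[OF f w] v_eq inv_eq[OF w p\<Delta>] by simp
  qed

  define c where "c = Max ((\<lambda>w. \<bar>scaling \<alpha> w\<bar>) ` I)"
  have finite_I: "finite I" by (simp add: I_def finite_multi_indices)
  \<comment> \<open>An empty index set would make the union of the pieces empty, but \<Delta> is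
    not. Together with finiteness this makes \<open>c\<close> a genuine maximum, so the strict bound
    on each scaling factor (where \<open>k \<ge> 1\<close> enters) carries over to
    \<open>c\<close>.\<close>
  have I_ne: "I \<noteq> {}" using cover nonempty by auto
  have c_ge: "\<bar>scaling \<alpha> w\<bar> \<le> c" if "w \<in> I" for w
    unfolding c_def using finite_I that by simp
  have "0 \<le> c" using I_ne c_ge abs_ge_zero order_trans by blast
  have "\<bar>scaling \<alpha> w\<bar> < 1" if "w \<in> I" for w
    using that k by (intro abs_scaling_less_1 scaling_lt_1) (auto simp: I_def multi_indices_def)
  then have "c < 1" unfolding c_def using finite_I I_ne by simp
  have contract: "sup_norm \<Delta> (\<lambda>x. T f1 x - T f2 x) \<le> c * sup_norm \<Delta> (\<lambda>x. f1 x - f2 x)"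
    if f: "f1 \<in> C0" "f2 \<in> C0" for f1 f2
    \<comment> \<open>Only the left-hand norm is unfolded, leaving a pointwise estimate against the
      fixed right-hand side.\<close>
    unfolding sup_norm_def[of _ "\<lambda>x. T f1 x - T f2 x"]
  proof (rule cSUP_least[OF nonempty])
    fix x assume "x \<in> \<Delta>"
    then obtain w where w: "w \<in> I" and x: "x \<in> piece \<Delta> L w" using cover by blast
    define y where "y = comp_map_inv \<Delta> L w x"
    \<comment> \<open>Using the same piece for both functions makes the terms in \<open>g\<close>
      and \<open>b\<close> cancel.\<close>
    have "T f1 x - T f2 x = scaling \<alpha> w * (f1 y - f2 y)"
      by (simp add: T_eq[OF f(1) w x] T_eq[OF f(2) w x] y_def algebra_simps)
    then have "\<bar>T f1 x - T f2 x\<bar> = \<bar>scaling \<alpha> w\<bar> * \<bar>f1 y - f2 y\<bar>" by (simp add: abs_mult)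
    also have "\<dots> \<le> c * sup_norm \<Delta> (\<lambda>x. f1 x - f2 x)"
    proof (rule mult_mono[OF c_ge[OF w] _ \<open>0 \<le> c\<close> abs_ge_zero])
      show "\<bar>f1 y - f2 y\<bar> \<le> sup_norm \<Delta> (\<lambda>x. f1 x - f2 x)"
        using f inv_in[OF x] unfolding C0_iff y_def
        by (intro abs_le_sup_norm[OF compact, of "\<lambda>x. f1 x - f2 x"] continuous_intros) auto
    qed
    finally show "\<bar>T f1 x - T f2 x\<bar> \<le> c * sup_norm \<Delta> (\<lambda>x. f1 x - f2 x)" .
  qed

  show ?thesis
    using cover T_eq T_C0 contract \<open>0 \<le> c\<close> \<open>c < 1\<close> unfolding I_def by blast
qed

end
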